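(* Let $\succsim$ be a CRDU preference relation on $\mathcal X$ represented by $u$, $g$, $\nu$, i.e. $u:\mathbb R\to\mathbb R$ is continuous and strictly increasing, $g$ is a continuous strictly increasing distortion function, $\nu$ is a continuous risk-conforming capacity, and $X\succsim Y\iff\int u(X)\,\mathrm d(g\circ\nu)\ge\int u(Y)\,\mathrm d(g\circ\nu)$ for all $X,Y\in\mathcal X$. Suppose $\succsim$ satisfies Property (NSC). Then there is a $g$-distortion family $(g_X)_{X\in\mathcal X}$ such that $$X\succsim Y\iff\int_\Omega u(X)\,\mathrm d(g_X\circ\mathbb Q)\ \ge\ \int_\Omega u(Y)\,\mathrm d(g_Y\circ\mathbb Q),\qquad X,Y\in\mathcal X,$$ and for each $X\in\mathcal X$ the function $g_X$ is uniquely determined on $\mathcal D(X)$ (any two $g$-distortion families giving this representation agree on $\mathcal D(X)$ for every $X$). Furthermore, $\succsim$ satisfies Property (RAA) if and only if $(g_X)_{X\in\mathcal X}$ is ambiguity averse.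
   Context: Setting. $(\Omega,\mathcal F)$ is a measurable space, $\mathcal G\subseteq\mathcal F$ is a sub-$\sigma$-algebra, and $\mathbb P:\mathcal G\to[0,1]$ is a (countably additive) probability measure that is atomless: $\{\mathbb P(B):B\in\mathcal G,\,B\subseteq A\}=[0,\mathbb P(A)]$ for every $A\in\mathcal G$. $\mathbb Q$ is a fixed (countably additive) probability measure on $(\Omega,\mathcal F)$ with $\mathbb Q|_{\mathcal G}=\mathbb P$. $\mathcal X$ is the set of acts, i.e. bounded $\mathcal F$-measurable functions $X:\Omega\to\mathbb R$; $\mathcal X(\mathcal G)$ is the set of $\mathcal G$-measurable acts. A preference relation $\succsim$ is a total preorder on $\mathcal X$ with symmetric part $\simeq$. A capacity is $\nu:\mathcal F\to\mathbb R$ with $\nu(\varnothing)=0$, $\nu(\Omega)=1$, and $\nu(A)\le\nu(B)$ whenever $A\subseteq B$. It is continuous if $\nu(A_n)\to\nu(\bigcup_n A_n)$ for increasing sequences and $\nu(A_n)\to\nu(\bigcap_n A_n)$ for decreasing sequences. It is risk conforming if $\nu|_{\mathcal G}=\mathbb P$. A distortion function is an increasing (non-strict) $g:[0,1]\to[0,1]$ with $g(0)=0$, $g(1)=1$. The Choquet integral with respect to a capacity $\kappa$ is $\int X\,\mathrm d\kappa=\int_0^\infty\kappa(X>x)\,\mathrm dx+\int_{-\infty}^0(\kappa(X>x)-1)\,\mathrm dx$. Acts $X,Y$ are comonotonic if $(X(\omega)-X(\tilde\omega))(Y(\omega)-Y(\tilde\omega))\ge0$ for all $\omega,\tilde\omega\in\Omega$.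 Property (NSC): for all $X,Y\in\mathcal X$ with $\mathbb Q(X=Y)=1$, $X\simeq Y$. Property (RAA): for all $X\in\mathcal X(\mathcal G)$ and $Y\in\mathcal X$ with $\mathbb Q(X>x)=\mathbb Q(Y>x)$ for all $x\in\mathbb R$, $X\succsim Y$. For $X\in\mathcal X$, $\mathcal D(X)=\{\mathbb Q(X>x):x\in\mathbb R\}\subseteq[0,1]$. A distortion family is a family $(g_X)_{X\in\mathcal X}$ of distortion functions such that: (a) for all $A\subseteq B$ in $\mathcal F$, $g_{\mathbf 1_A}(\alpha)\le g_{\mathbf 1_B}(\alpha)$ for all $\alpha\in[0,1]$; (b) for all $X\in\mathcal X$, the restriction of $g_X$ to $\mathcal D(X)$ is continuous; (c) for all comonotonic $X,Y\in\mathcal X$, $g_X(\alpha)=g_Y(\alpha)$ for all $\alpha\in\mathcal D(X)\cap\mathcal D(Y)$. For a distortion function $g$, a $g$-distortion family is a distortion family with $g_X(\alpha)=g(\alpha)$ for all $X\in\mathcal X(\mathcal G)$, $\alpha\in\mathcal D(X)$. A $g$-distortion family is ambiguity averse if $g_X(\alpha)\le g(\alpha)$ for all $X\in\mathcal X$ and $\alpha\in\mathcal D(X)$. *)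

theory Defs
  imports "HOL-Probability.Probability"
begin

text \<open>A probability measure on \<open>\<G>\<close> is represented by a measure \<open>P\<close> with \<open>sets P = \<G>\<close>.\<close>

definition atomless :: "'a measure \<Rightarrow> bool" where
  "atomless P \<longleftrightarrow> (\<forall>A\<in>sets P. measure P ` {B \<in> sets P. B \<subseteq> A} = {0..measure P A})"

text \<open>Acts are extensional, so that two acts are equal in HOL exactly if they agree on
  \<open>\<Omega> = space M\<close>.\<close>

definition acts :: "'a measure \<Rightarrow> ('a \<Rightarrow> real) set" where
  "acts M = {X \<in> extensional (space M). X \<in> borel_measurable M \<and> bounded (X ` space M)}"

definition indicator_act :: "'a measure \<Rightarrow> 'a set \<Rightarrow> 'a \<Rightarrow> real" where
  "indicator_act M A = restrict (indicator A) (space M)"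

definition upper_level :: "'a set \<Rightarrow> ('a \<Rightarrow> real) \<Rightarrow> real \<Rightarrow> 'a set" where
  "upper_level \<Omega> X x = {\<omega> \<in> \<Omega>. X \<omega> > x}"

definition comonotonic :: "'a set \<Rightarrow> ('a \<Rightarrow> real) \<Rightarrow> ('a \<Rightarrow> real) \<Rightarrow> bool" where
  "comonotonic \<Omega> X Y \<longleftrightarrow> (\<forall>\<omega>\<in>\<Omega>. \<forall>\<omega>'\<in>\<Omega>. (X \<omega> - X \<omega>') * (Y \<omega> - Y \<omega>') \<ge> 0)"

text \<open>Capacities are set functions of which only the values on \<open>sets M\<close> matter.\<close>

definition capacity :: "'a measure \<Rightarrow> ('a set \<Rightarrow> real) \<Rightarrow> bool" where
  "capacity M \<nu> \<longleftrightarrow> \<nu> {} = 0 \<and> \<nu> (space M) = 1 \<and>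
     (\<forall>A\<in>sets M. \<forall>B\<in>sets M. A \<subseteq> B \<longrightarrow> \<nu> A \<le> \<nu> B)"

definition continuous_capacity :: "'a measure \<Rightarrow> ('a set \<Rightarrow> real) \<Rightarrow> bool" where
  "continuous_capacity M \<nu> \<longleftrightarrow> capacity M \<nu> \<and>
     (\<forall>A. range A \<subseteq> sets M \<and> incseq A \<longrightarrow> (\<lambda>n::nat. \<nu> (A n)) \<longlonglongrightarrow> \<nu> (\<Union>n. A n)) \<and>
     (\<forall>A. range A \<subseteq> sets M \<and> decseq A \<longrightarrow> (\<lambda>n::nat. \<nu> (A n)) \<longlonglongrightarrow> \<nu> (\<Inter>n. A n))"

definition risk_conforming :: "'a measure \<Rightarrow> ('a set \<Rightarrow> real) \<Rightarrow> bool" where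
  "risk_conforming P \<nu> \<longleftrightarrow> (\<forall>A\<in>sets P. \<nu> A = measure P A)"

definition choquet :: "'a set \<Rightarrow> ('a set \<Rightarrow> real) \<Rightarrow> ('a \<Rightarrow> real) \<Rightarrow> real" where
  "choquet \<Omega> \<kappa> X =
     (LBINT x:{0..}. \<kappa> (upper_level \<Omega> X x)) + (LBINT x:{..0}. \<kappa> (upper_level \<Omega> X x) - 1)"

definition distortion :: "(real \<Rightarrow> real) \<Rightarrow> bool" where
  "distortion g \<longleftrightarrow> g ` {0..1} \<subseteq> {0..1} \<and> mono_on {0..1} g \<and> g 0 = 0 \<and> g 1 = 1"

text \<open>Throughout, \<open>R X Y\<close> stands for \<open>X \<succsim> Y\<close>, and \<open>P\<close> is the restriction of \<open>Q\<close> to \<open>\<G>\<close>.\<close>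

definition preference :: "'a measure \<Rightarrow> (('a \<Rightarrow> real) \<Rightarrow> ('a \<Rightarrow> real) \<Rightarrow> bool) \<Rightarrow> bool" where
  "preference M R \<longleftrightarrow> reflp_on (acts M) R \<and> transp_on (acts M) R \<and> totalp_on (acts M) R"

definition CRDU ::
  "'a measure \<Rightarrow> 'a measure \<Rightarrow> (('a \<Rightarrow> real) \<Rightarrow> ('a \<Rightarrow> real) \<Rightarrow> bool)
     \<Rightarrow> (real \<Rightarrow> real) \<Rightarrow> (real \<Rightarrow> real) \<Rightarrow> ('a set \<Rightarrow> real) \<Rightarrow> bool" where
  "CRDU M P R u g \<nu> \<longleftrightarrow> preference M R \<and>
     continuous_on UNIV u \<and> strict_mono u \<and>
     distortion g \<and> continuous_on {0..1} g \<and> strict_mono_on {0..1} g \<and>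
     continuous_capacity M \<nu> \<and> risk_conforming P \<nu> \<and>
     (\<forall>X\<in>acts M. \<forall>Y\<in>acts M.
        R X Y \<longleftrightarrow> choquet (space M) (g \<circ> \<nu>) (u \<circ> X) \<ge> choquet (space M) (g \<circ> \<nu>) (u \<circ> Y))"

definition NSC :: "'a measure \<Rightarrow> (('a \<Rightarrow> real) \<Rightarrow> ('a \<Rightarrow> real) \<Rightarrow> bool) \<Rightarrow> bool" where
  "NSC Q R \<longleftrightarrow> (\<forall>X\<in>acts Q. \<forall>Y\<in>acts Q.
     measure Q {\<omega> \<in> space Q. X \<omega> = Y \<omega>} = 1 \<longrightarrow> R X Y \<and> R Y X)"

definition RAA :: "'a measure \<Rightarrow> 'a measure \<Rightarrow> (('a \<Rightarrow> real) \<Rightarrow> ('a \<Rightarrow> real) \<Rightarrow> bool) \<Rightarrow> bool" where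
  "RAA Q P R \<longleftrightarrow> (\<forall>X\<in>acts P. \<forall>Y\<in>acts Q.
     (\<forall>x. measure Q (upper_level (space Q) X x) = measure Q (upper_level (space Q) Y x)) \<longrightarrow> R X Y)"

definition level_probs :: "'a measure \<Rightarrow> ('a \<Rightarrow> real) \<Rightarrow> real set" where
  "level_probs Q X = range (\<lambda>x. measure Q (upper_level (space Q) X x))"

definition distortion_family :: "'a measure \<Rightarrow> (('a \<Rightarrow> real) \<Rightarrow> real \<Rightarrow> real) \<Rightarrow> bool" where
  "distortion_family Q G \<longleftrightarrow>
     (\<forall>X\<in>acts Q. distortion (G X)) \<and>
     (\<forall>A\<in>sets Q. \<forall>B\<in>sets Q. A \<subseteq> B \<longrightarrow>
        (\<forall>\<alpha>\<in>{0..1}. G (indicator_act Q A) \<alpha> \<le> G (indicator_act Q B) \<alpha>)) \<and>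
     (\<forall>X\<in>acts Q. continuous_on (level_probs Q X) (G X)) \<and>
     (\<forall>X\<in>acts Q. \<forall>Y\<in>acts Q. comonotonic (space Q) X Y \<longrightarrow>
        (\<forall>\<alpha>\<in>level_probs Q X \<inter> level_probs Q Y. G X \<alpha> = G Y \<alpha>))"

definition g_distortion_family ::
  "'a measure \<Rightarrow> 'a measure \<Rightarrow> (real \<Rightarrow> real) \<Rightarrow> (('a \<Rightarrow> real) \<Rightarrow> real \<Rightarrow> real) \<Rightarrow> bool" where
  "g_distortion_family Q P g G \<longleftrightarrow> distortion_family Q G \<and>
     (\<forall>X\<in>acts P. \<forall>\<alpha>\<in>level_probs Q X. G X \<alpha> = g \<alpha>)"

definition ambiguity_averse ::
  "'a measure \<Rightarrow> (real \<Rightarrow> real) \<Rightarrow> (('a \<Rightarrow> real) \<Rightarrow> real \<Rightarrow> real) \<Rightarrow> bool" where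
  "ambiguity_averse Q g G \<longleftrightarrow> (\<forall>X\<in>acts Q. \<forall>\<alpha>\<in>level_probs Q X. G X \<alpha> \<le> g \<alpha>)"

definition family_represents ::
  "'a measure \<Rightarrow> (('a \<Rightarrow> real) \<Rightarrow> ('a \<Rightarrow> real) \<Rightarrow> bool)
     \<Rightarrow> (real \<Rightarrow> real) \<Rightarrow> (('a \<Rightarrow> real) \<Rightarrow> real \<Rightarrow> real) \<Rightarrow> bool" where
  "family_represents Q R u G \<longleftrightarrow> (\<forall>X\<in>acts Q. \<forall>Y\<in>acts Q.
     R X Y \<longleftrightarrow> choquet (space Q) (G X \<circ> measure Q) (u \<circ> X)
             \<ge> choquet (space Q) (G Y \<circ> measure Q) (u \<circ> Y))"

end

theory Submission
  imports Defs
begin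

text \<open>Every family must satisfy \<open>G X (Q (X > x)) = g (\<nu> (X > x))\<close>, and this formula also defines one.
  Its right-hand side depends on \<open>Q (X > x)\<close> only: upper level sets of comonotonic acts are nested, and
  NSC, applied to indicators, makes \<open>\<nu>\<close> agree on events that differ by a \<open>Q\<close>-null set. With
  Borel--Cantelli, null invariance also makes \<open>g \<circ> \<nu>\<close> continuous for the pseudometric
  \<open>Q (A \<triangle> B)\<close>, which is the continuity of \<open>G X\<close> on the level probabilities. Finally, RAA and
  ambiguity aversion are both equivalent to \<open>g (\<nu> A) \<le> g (Q A)\<close> for all events \<open>A\<close>.\<close>

section \<open>Capacities\<close>

lemma capacity_bounds:
  assumes "capacity M \<nu>" "A \<in> sets M"
  shows "0 \<le> \<nu> A" "\<nu> A \<le> 1"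
  using assms sets.sets_into_space[OF assms(2)] unfolding capacity_def
  by (metis empty_subsetI sets.empty_sets, metis sets.top)

text \<open>The preference sees \<open>\<nu>\<close> only through \<open>g \<circ> \<nu>\<close>.
  The values of \<open>\<nu>\<close> stay in the unit interval, where \<open>g\<close> is
  continuous, so limits along monotone sequences pass through \<open>g\<close>.\<close>

lemma continuous_capacity_distortion:
  assumes \<nu>: "continuous_capacity M \<nu>" and g: "distortion g" "continuous_on {0..1} g"
  shows "continuous_capacity M (g \<circ> \<nu>)"
proof -
  have cap: "capacity M \<nu>"
    using \<nu> by (simp add: continuous_capacity_def)
  have lim: "(\<lambda>n. g (\<nu> (A n))) \<longlonglongrightarrow> g (\<nu> B)"
    if "(\<lambda>n. \<nu> (A n)) \<longlonglongrightarrow> \<nu> B" "range A \<subseteq> sets M" "B \<in> sets M" for A :: "nat \<Rightarrow> _" and B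
    using that capacity_bounds[OF cap]
    by (intro continuous_on_tendsto_compose[OF g(2)]) (auto simp: range_subsetD)
  have "capacity M (g \<circ> \<nu>)"
    using cap g(1) capacity_bounds[OF cap]
    by (auto simp: capacity_def distortion_def intro!: mono_onD[of "{0..1}" g])
  moreover have "(\<lambda>n. g (\<nu> (A n))) \<longlonglongrightarrow> g (\<nu> (\<Union>n. A n))" if "range A \<subseteq> sets M" "incseq A" for A
    using \<nu> that by (intro lim) (auto simp: continuous_capacity_def)
  moreover have "(\<lambda>n. g (\<nu> (A n))) \<longlonglongrightarrow> g (\<nu> (\<Inter>n. A n))" if "range A \<subseteq> sets M" "decseq A" for A
    using \<nu> that by (intro lim) (auto simp: continuous_capacity_def)
  ultimately show ?thesis
    by (simp add: continuous_capacity_def)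
qed

text \<open>Complementation exchanges increasing and decreasing sequences. The dual capacity later
  turns an upper bound into a lower one.\<close>

lemma continuous_capacity_dual:
  assumes \<nu>: "continuous_capacity M \<nu>"
  shows "continuous_capacity M (\<lambda>A. 1 - \<nu> (space M - A))"
  unfolding continuous_capacity_def
proof (intro conjI allI impI)
  show "capacity M (\<lambda>A. 1 - \<nu> (space M - A))"
    using \<nu> by (auto simp: continuous_capacity_def capacity_def Diff_mono)
  fix A :: "nat \<Rightarrow> 'a set"
  {
    assume A: "range A \<subseteq> sets M \<and> incseq A"
    have "(\<lambda>n. \<nu> (space M - A n)) \<longlonglongrightarrow> \<nu> (\<Inter>n. space M - A n)"
      using \<nu> A unfolding continuous_capacity_def
      by (auto simp: decseq_def incseq_def image_subset_iff dest!: spec[of _ "\<lambda>n. space M - A n"])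
    moreover have "(\<Inter>n. space M - A n) = space M - (\<Union>n. A n)"
      by auto
    ultimately show "(\<lambda>n. 1 - \<nu> (space M - A n)) \<longlonglongrightarrow> 1 - \<nu> (space M - (\<Union>n. A n))"
      by (auto intro: tendsto_intros)
  next
    assume A: "range A \<subseteq> sets M \<and> decseq A"
    have "(\<lambda>n. \<nu> (space M - A n)) \<longlonglongrightarrow> \<nu> (\<Union>n. space M - A n)"
      using \<nu> A unfolding continuous_capacity_def
      by (auto simp: decseq_def incseq_def image_subset_iff dest!: spec[of _ "\<lambda>n. space M - A n"])
    moreover have "(\<Union>n. space M - A n) = space M - (\<Inter>n. A n)"
      by auto
    ultimately show "(\<lambda>n. 1 - \<nu> (space M - A n)) \<longlonglongrightarrow> 1 - \<nu> (space M - (\<Inter>n. A n))"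
      by (auto intro: tendsto_intros)
  }
qed

text \<open>Otherwise there are events \<open>B n\<close> converging fast to \<open>A\<close> whose
  capacities exceed \<open>\<kappa> A\<close> by at least \<open>e\<close>. Their tail unions keep
  that excess by monotonicity, yet decrease to an event equal to \<open>A\<close> almost
  surely.\<close>

lemma capacity_upper_semicontinuous:
  fixes \<kappa> :: "'a set \<Rightarrow> real"
  assumes "prob_space Q" and \<kappa>: "continuous_capacity Q \<kappa>"
    and null: "\<And>A B. \<lbrakk>A \<in> sets Q; B \<in> sets Q; AE \<omega> in Q. \<omega> \<in> A \<longleftrightarrow> \<omega> \<in> B\<rbrakk> \<Longrightarrow> \<kappa> A = \<kappa> B"
    and A: "A \<in> sets Q" and "e > 0"
  shows "\<exists>d>0. \<forall>B\<in>sets Q. measure Q (sym_diff A B) < d \<longrightarrow> \<kappa> B < \<kappa> A + e"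
proof (rule ccontr)
  interpret prob_space Q by fact
  assume "\<not> ?thesis"
  then have "\<exists>B\<in>sets Q. measure Q (sym_diff A B) < d \<and> \<kappa> B \<ge> \<kappa> A + e" if "d > 0" for d :: real
    using that by (auto simp: not_less dest!: spec[of _ d])
  \<comment> \<open>Geometric radii make the distances to \<open>A\<close> summable, as
    Borel--Cantelli requires.\<close>
  from this[of "(1/2)^n" for n]
  have "\<exists>B\<in>sets Q. measure Q (sym_diff A B) < (1/2)^n \<and> \<kappa> B \<ge> \<kappa> A + e" for n :: nat
    by simp
  then obtain B where B: "\<And>n::nat. B n \<in> sets Q" "\<And>n. measure Q (sym_diff A (B n)) < (1/2)^n"
    "\<And>n. \<kappa> (B n) \<ge> \<kappa> A + e"
    by metis
  \<comment> \<open>Borel--Cantelli: \<open>A\<close> and \<open>limsup B\<close> differ by a null set only.\<close>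
  define C where "C n = (\<Union>k\<in>{n..}. B k)" for n
  have C: "C n \<in> sets Q" for n
    using B(1) by (auto simp: C_def)
  have "summable (\<lambda>n. measure Q (sym_diff A (B n)))"
    using B(2) by (intro summable_comparison_test[OF _ summable_geometric[of "1/2::real"]])
      (auto intro: less_imp_le)
  then have "AE \<omega> in Q. eventually (\<lambda>n. \<omega> \<in> space Q - sym_diff A (B n)) sequentially"
    using A B(1) by (intro borel_cantelli_AE1) (auto simp: emeasure_eq_measure)
  then have "AE \<omega> in Q. \<omega> \<in> (\<Inter>n. C n) \<longleftrightarrow> \<omega> \<in> A"
  proof (eventually_elim)
    case (elim \<omega>)
    then obtain N where N: "\<And>n. n \<ge> N \<Longrightarrow> \<omega> \<in> B n \<longleftrightarrow> \<omega> \<in> A"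
      by (auto simp: eventually_sequentially)
    then show ?case
    proof (intro iffI)
      assume "\<omega> \<in> (\<Inter>n. C n)"
      then have "\<omega> \<in> C N"
        by blast
      then show "\<omega> \<in> A"
        using N by (auto simp: C_def)
    next
      assume "\<omega> \<in> A"
      then have "\<omega> \<in> C n" for n
        using N by (auto simp: C_def intro!: bexI[of _ "max n N"])
      then show "\<omega> \<in> (\<Inter>n. C n)"
        by blast
    qed
  qed
  then have "\<kappa> (\<Inter>n. C n) = \<kappa> A"
    using A C by (intro null) auto
  moreover have "decseq C"
    unfolding decseq_def C_def by (intro allI impI UN_mono) auto
  ultimately have "(\<lambda>n. \<kappa> (C n)) \<longlonglongrightarrow> \<kappa> A"
    using \<kappa> C unfolding continuous_capacity_def by (metis image_subsetI)
  moreover have "\<kappa> A + e \<le> \<kappa> (C n)" for n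
  proof -
    have "\<kappa> (B n) \<le> \<kappa> (C n)"
      using \<kappa> B(1) C unfolding continuous_capacity_def capacity_def
      by (metis C_def UN_upper atLeast_iff order_refl)
    then show ?thesis
      using B(3)[of n] by simp
  qed
  ultimately have "\<kappa> A + e \<le> \<kappa> A"
    by (intro LIMSEQ_le_const) auto
  with \<open>e > 0\<close> show False
    by simp
qed

text \<open>The lower bound is upper semicontinuity of the dual capacity at the complement of
  \<open>A\<close>: complementing both events leaves their symmetric difference unchanged.\<close>

lemma capacity_continuous_sym_diff:
  fixes \<kappa> :: "'a set \<Rightarrow> real"
  assumes Q: "prob_space Q" and \<kappa>: "continuous_capacity Q \<kappa>"
    and null: "\<And>A B. \<lbrakk>A \<in> sets Q; B \<in> sets Q; AE \<omega> in Q. \<omega> \<in> A \<longleftrightarrow> \<omega> \<in> B\<rbrakk> \<Longrightarrow> \<kappa> A = \<kappa> B"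
    and A: "A \<in> sets Q" and "e > 0"
  shows "\<exists>d>0. \<forall>B\<in>sets Q. measure Q (sym_diff A B) < d \<longrightarrow> \<bar>\<kappa> B - \<kappa> A\<bar> < e"
proof -
  obtain d1 where d1: "d1 > 0"
    "\<And>B. \<lbrakk>B \<in> sets Q; measure Q (sym_diff A B) < d1\<rbrakk> \<Longrightarrow> \<kappa> B < \<kappa> A + e"
    using capacity_upper_semicontinuous[OF assms] by metis
  have "\<exists>d>0. \<forall>B\<in>sets Q. measure Q (sym_diff (space Q - A) B) < d \<longrightarrow>
      1 - \<kappa> (space Q - B) < 1 - \<kappa> (space Q - (space Q - A)) + e"
  proof (rule capacity_upper_semicontinuous[OF Q continuous_capacity_dual[OF \<kappa>]])
    fix A B assume AB: "A \<in> sets Q" "B \<in> sets Q" "AE \<omega> in Q. \<omega> \<in> A \<longleftrightarrow> \<omega> \<in> B"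
    then have "\<kappa> (space Q - A) = \<kappa> (space Q - B)"
      by (intro null) auto
    then show "1 - \<kappa> (space Q - A) = 1 - \<kappa> (space Q - B)"
      by simp
  qed (use A \<open>e > 0\<close> in auto)
  then obtain d2 where d2: "d2 > 0"
    "\<And>B. \<lbrakk>B \<in> sets Q; measure Q (sym_diff (space Q - A) B) < d2\<rbrakk> \<Longrightarrow>
      1 - \<kappa> (space Q - B) < 1 - \<kappa> (space Q - (space Q - A)) + e"
    by metis
  show ?thesis
  proof (intro exI[of _ "min d1 d2"] conjI ballI impI)
    fix B assume B: "B \<in> sets Q" "measure Q (sym_diff A B) < min d1 d2"
    note sub = sets.sets_into_space[OF A] sets.sets_into_space[OF B(1)]
    have "sym_diff (space Q - A) (space Q - B) = sym_diff A B"
      "space Q - (space Q - A) = A" "space Q - (space Q - B) = B"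
      using sub by auto
    then have "\<kappa> A < \<kappa> B + e"
      using d2(2)[of "space Q - B"] B by auto
    moreover have "\<kappa> B < \<kappa> A + e"
      using d1(2) B by auto
    ultimately show "\<bar>\<kappa> B - \<kappa> A\<bar> < e"
      by linarith
  qed (use d1 d2 in auto)
qed

section \<open>Level sets and Choquet integrals\<close>

text \<open>The strict bound makes the upper level set at \<open>-K\<close> the whole space.\<close>

lemma actsE:
  assumes "X \<in> acts M"
  obtains K where "K > 0" "\<And>\<omega>. \<omega> \<in> space M \<Longrightarrow> \<bar>X \<omega>\<bar> < K"
proof -
  obtain a where "\<And>\<omega>. \<omega> \<in> space M \<Longrightarrow> \<bar>X \<omega>\<bar> \<le> a"
    using assms by (auto simp: acts_def bounded_iff)
  then show ?thesis
    by (intro that[of "\<bar>a\<bar> + 1"]) fastforce+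
qed

lemma upper_level_sets: "X \<in> acts M \<Longrightarrow> upper_level (space M) X x \<in> sets M"
  by (auto simp: acts_def upper_level_def)

lemma upper_level_antimono: "x \<le> y \<Longrightarrow> upper_level \<Omega> X y \<subseteq> upper_level \<Omega> X x"
  by (auto simp: upper_level_def)

text \<open>A point in each of the two differences would give a pair that \<open>X\<close> and
  \<open>Y\<close> order in opposite ways.\<close>

lemma comonotonic_upper_levels:
  assumes "comonotonic \<Omega> X Y"
  shows "upper_level \<Omega> X x \<subseteq> upper_level \<Omega> Y y \<or> upper_level \<Omega> Y y \<subseteq> upper_level \<Omega> X x"
proof (rule ccontr)
  assume "\<not> ?thesis"
  then obtain a b where "a \<in> \<Omega>" "b \<in> \<Omega>" "X a > x" "Y a \<le> y" "Y b > y" "X b \<le> x"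
    unfolding upper_level_def de_Morgan_disj subset_eq by (auto simp: not_less)
  then have "(X a - X b) * (Y a - Y b) < 0"
    by (intro mult_pos_neg) auto
  then show False
    using assms \<open>a \<in> \<Omega>\<close> \<open>b \<in> \<Omega>\<close> by (fastforce simp: comonotonic_def)
qed

text \<open>The indicator is an increasing function of \<open>X\<close>. This lets condition (c)
  carry values of a family from \<open>X\<close> to indicator acts.\<close>

lemma comonotonic_indicator_upper_level:
  "comonotonic (space M) X (indicator_act M (upper_level (space M) X x))"
  by (auto simp: comonotonic_def indicator_act_def upper_level_def indicator_def)

lemma indicator_act_acts: "A \<in> sets M \<Longrightarrow> indicator_act M A \<in> acts M"
  by (auto simp: acts_def indicator_act_def bounded_iff indicator_def intro!: exI[of _ 1]
      cong: measurable_cong)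

lemma upper_level_indicator_act:
  assumes "A \<in> sets M"
  shows "upper_level (space M) (indicator_act M A) x =
    (if x < 0 then space M else if x < 1 then A else {})"
  using sets.sets_into_space[OF assms]
  by (auto simp: upper_level_def indicator_act_def indicator_def split: if_splits)

text \<open>The threshold \<open>y\<close> depends on \<open>u\<close>, \<open>K\<close> and
  \<open>x\<close> but not on the act, so two acts with a common bound can be compared at the same
  \<open>y\<close>. Between \<open>u (-K)\<close> and \<open>u K\<close> it is a preimage of
  \<open>x\<close>; beyond them the level set is trivial and \<open>-K\<close> or \<open>K\<close>
  serves.\<close>

lemma upper_level_strict_mono_comp:
  assumes u: "continuous_on UNIV u" "strict_mono u" and "K > 0"
  obtains y :: real where "\<And>\<Omega> X. (\<And>\<omega>. \<omega> \<in> \<Omega> \<Longrightarrow> \<bar>X \<omega>\<bar> < K) \<Longrightarrow>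
    upper_level \<Omega> (u \<circ> X) x = upper_level \<Omega> X y"
proof -
  note mono = strict_mono_less[OF u(2)]
  consider "x \<le> u (-K)" | "x \<ge> u K" | "u (-K) < x" "x < u K"
    by linarith
  then show ?thesis
  proof cases
    case 1
    show ?thesis
    proof (rule that[of "-K"])
      fix \<Omega> :: "'c set" and X assume "\<And>\<omega>. \<omega> \<in> \<Omega> \<Longrightarrow> \<bar>X \<omega>\<bar> < K"
      then have K: "- K < X \<omega>" if "\<omega> \<in> \<Omega>" for \<omega>
        using that by (simp add: abs_less_iff minus_less_iff)
      then have "x < u (X \<omega>)" if "\<omega> \<in> \<Omega>" for \<omega>
        using that 1 by (intro le_less_trans[of x "u (- K)"]) (simp_all add: mono)
      with K show "upper_level \<Omega> (u \<circ> X) x = upper_level \<Omega> X (- K)"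
        by (auto simp: upper_level_def)
    qed
  next
    case 2
    show ?thesis
    proof (rule that[of K])
      fix \<Omega> :: "'c set" and X assume "\<And>\<omega>. \<omega> \<in> \<Omega> \<Longrightarrow> \<bar>X \<omega>\<bar> < K"
      then have K: "X \<omega> < K" if "\<omega> \<in> \<Omega>" for \<omega>
        using that by (simp add: abs_less_iff)
      then have "u (X \<omega>) < x" if "\<omega> \<in> \<Omega>" for \<omega>
        using that 2 by (intro less_le_trans[of _ "u K" x]) (simp_all add: mono)
      with K show "upper_level \<Omega> (u \<circ> X) x = upper_level \<Omega> X K"
        by (fastforce simp: upper_level_def)
    qed
  next
    case 3
    then obtain y where "u y = x"
      using IVT'[of u "-K" x K] \<open>K > 0\<close> continuous_on_subset[OF u(1), of "{-K..K}"] by auto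
    then show ?thesis
      using mono by (intro that[of y]) (auto simp: upper_level_def)
  qed
qed

section \<open>Evaluation and comparison of Choquet integrals\<close>

lemma choquet_cong:
  assumes "\<And>x. \<kappa> (upper_level \<Omega> X x) = \<kappa>' (upper_level \<Omega> Y x)"
  shows "choquet \<Omega> \<kappa> X = choquet \<Omega> \<kappa>' Y"
  by (simp add: choquet_def assms)

text \<open>This is the layer-cake formula for a constant \<open>a\<close> of either sign: the
  lengths of \<open>{0..<a}\<close> and \<open>{a..0}\<close> differ by \<open>a\<close>.\<close>

lemma lborel_set_integral_step:
  fixes a c :: real
  shows "set_integrable lborel {0..} (\<lambda>x. c * indicator {..<a} x)"
    "set_integrable lborel {..0} (\<lambda>x. c * indicator {a..} x)"
    "(LBINT x:{0..}. c * indicator {..<a} x) - (LBINT x:{..0}. c * indicator {a..} x) = c * a"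
proof -
  have *: "(\<lambda>x. indicator {0..} x *\<^sub>R (c * indicator {..<a} x)) = (\<lambda>x. c * indicator {0..<a} x)"
    "(\<lambda>x. indicator {..0} x *\<^sub>R (c * indicator {a..} x)) = (\<lambda>x. c * indicator {a..0} x)"
    by (auto simp: indicator_def fun_eq_iff)
  have int: "integrable lborel (\<lambda>x. c * indicator {0..<a} x)"
    "integrable lborel (\<lambda>x. c * indicator {a..0} x)"
    by (intro integrable_mult_right integrable_real_indicator; cases "0 \<le> a";
        simp add: emeasure_lborel_Icc_eq)+
  then show "set_integrable lborel {0..} (\<lambda>x. c * indicator {..<a} x)"
    "set_integrable lborel {..0} (\<lambda>x. c * indicator {a..} x)"
    unfolding set_integrable_def * by auto
  have "measure lborel {0..<a} - measure lborel {a..0} = a"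
    by (cases "0 \<le> a") (simp_all add: measure_def emeasure_lborel_Icc_eq)
  then have "c * measure lborel {0..<a} - c * measure lborel {a..0} = c * a"
    by (simp flip: right_diff_distrib)
  then show "(LBINT x:{0..}. c * indicator {..<a} x) - (LBINT x:{..0}. c * indicator {a..} x) = c * a"
    unfolding set_lebesgue_integral_def * integral_mult_right_zero by simp
qed

text \<open>The value is affine in \<open>\<kappa> A\<close> with slope
  \<open>u 1 - u 0 > 0\<close>, so preferences between bets reveal the capacity of events.\<close>

lemma choquet_indicator_act:
  assumes A: "A \<in> sets M" and "\<kappa> {} = 0" "\<kappa> (space M) = 1" and u: "strict_mono u"
  shows "choquet (space M) \<kappa> (u \<circ> indicator_act M A) = u 0 + (u 1 - u 0) * \<kappa> A"
proof -
  define c where "c = \<kappa> A"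
  have "u 0 < u 1"
    using u by (simp add: strict_mono_less)
  have level: "upper_level (space M) (u \<circ> indicator_act M A) x =
    (if x < u 0 then space M else if x < u 1 then A else {})" for x
    using sets.sets_into_space[OF A] \<open>u 0 < u 1\<close>
    by (auto simp: upper_level_def indicator_act_def indicator_def split: if_splits)
  \<comment> \<open>The level function takes the values 1, \<open>c\<close>, 0; it is a mixture of a
    step at \<open>u 0\<close> and a step at \<open>u 1\<close> with weights \<open>1 - c\<close>
    and \<open>c\<close>.\<close>
  have *: "\<kappa> (upper_level (space M) (u \<circ> indicator_act M A) x) =
      (1 - c) * indicator {..<u 0} x + c * indicator {..<u 1} x"
    "\<kappa> (upper_level (space M) (u \<circ> indicator_act M A) x) - 1 =
      - ((1 - c) * indicator {u 0..} x + c * indicator {u 1..} x)" for x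
    using \<open>u 0 < u 1\<close> assms(2,3) by (auto simp: level c_def)
  have "choquet (space M) \<kappa> (u \<circ> indicator_act M A) =
      ((LBINT x:{0..}. (1 - c) * indicator {..<u 0} x) + (LBINT x:{0..}. c * indicator {..<u 1} x)) -
      ((LBINT x:{..0}. (1 - c) * indicator {u 0..} x) + (LBINT x:{..0}. c * indicator {u 1..} x))"
    unfolding choquet_def *(2) unfolding *(1)
    by (simp only: set_integral_uminus set_integral_add lborel_set_integral_step(1,2) add_uminus_conv_diff)
  also have "\<dots> = (1 - c) * u 0 + c * u 1"
    using lborel_set_integral_step(3)[of "1 - c" "u 0"] lborel_set_integral_step(3)[of c "u 1"]
    by linarith
  finally have "choquet (space M) \<kappa> (u \<circ> indicator_act M A) = (1 - c) * u 0 + c * u 1" .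
  then show ?thesis
    by (simp add: c_def algebra_simps)
qed

text \<open>Non-integrable functions have integral 0 by convention, so a pointwise comparison needs
  integrability. It comes from monotonicity (measurability), boundedness, and constancy outside
  \<open>{-L..L}\<close>.\<close>

lemma choquet_mono:
  assumes anti: "antimono F" "antimono F'"
    and low: "\<And>x. x < - L \<Longrightarrow> F x = 1 \<and> F' x = 1" and up: "\<And>x. x > L \<Longrightarrow> F x = 0 \<and> F' x = 0"
    and bd: "\<And>x. 0 \<le> F x" "\<And>x. F' x \<le> 1"
    and le: "\<And>x. F x \<le> F' x"
    and F: "\<And>x. F x = \<kappa> (upper_level \<Omega> X x)" and F': "\<And>x. F' x = \<kappa>' (upper_level \<Omega> Y x)"
  shows "choquet \<Omega> \<kappa> X \<le> choquet \<Omega> \<kappa>' Y"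
proof -
  have meas: "H \<in> borel_measurable borel" if "antimono H" for H :: "real \<Rightarrow> real"
  proof -
    have "(\<lambda>x. - H x) \<in> borel_measurable borel"
      using that by (intro borel_measurable_mono) (auto simp: mono_def antimono_def)
    then show ?thesis
      by simp
  qed
  have "set_integrable lborel {0..} H \<and> set_integrable lborel {..0} (\<lambda>x. H x - 1)"
    if H: "antimono H" "\<And>x. x < - L \<Longrightarrow> H x = 1" "\<And>x. x > L \<Longrightarrow> H x = 0" "\<And>x. 0 \<le> H x" "\<And>x. H x \<le> 1" for H :: "real \<Rightarrow> real"
  proof
    \<comment> \<open>On its half-line each integrand is bounded by 1 and vanishes outside this
      interval, so the indicator dominates it.\<close>
    have int: "integrable lborel (indicator {-\<bar>L\<bar>..\<bar>L\<bar>} :: real \<Rightarrow> real)"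
      by simp
    have [measurable]: "H \<in> borel_measurable borel"
      using H(1) by (rule meas)
    show "set_integrable lborel {0..} H"
      unfolding set_integrable_def
      using H by (intro Bochner_Integration.integrable_bound[OF int]) (auto simp: indicator_def not_le)
    show "set_integrable lborel {..0} (\<lambda>x. H x - 1)"
      unfolding set_integrable_def
      using H by (intro Bochner_Integration.integrable_bound[OF int]) (auto simp: indicator_def not_le)
  qed
  from this[of F] this[of F'] show ?thesis
    unfolding choquet_def F[symmetric] F'[symmetric]
    using anti low up bd le order_trans[OF bd(1) le] order_trans[OF le bd(2)]
    by (intro add_mono set_integral_mono) auto
qed

section \<open>The distortion family of a CRDU preference\<close>

locale crdu_nsc = prob_space Q
  for Q P :: "'a measure" and R :: "('a \<Rightarrow> real) \<Rightarrow> ('a \<Rightarrow> real) \<Rightarrow> bool"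
    and u g :: "real \<Rightarrow> real" and \<nu> :: "'a set \<Rightarrow> real" +
  assumes subalg: "subalgebra Q P"
    and Q_eq_P: "\<And>A. A \<in> sets P \<Longrightarrow> measure Q A = measure P A"
    and atomless: "atomless P"
    and crdu: "CRDU Q P R u g \<nu>"
    and nsc: "NSC Q R"
begin

abbreviation level :: "('a \<Rightarrow> real) \<Rightarrow> real \<Rightarrow> 'a set" where
  "level \<equiv> upper_level (space Q)"

abbreviation \<kappa> :: "'a set \<Rightarrow> real" where
  "\<kappa> \<equiv> g \<circ> \<nu>"

lemma u: "continuous_on UNIV u" "strict_mono u"
  and g: "distortion g" "continuous_on {0..1} g" "strict_mono_on {0..1} g"
  and \<nu>: "continuous_capacity Q \<nu>" "capacity Q \<nu>" "\<And>A. A \<in> sets P \<Longrightarrow> \<nu> A = measure Q A"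
  using crdu by (auto simp: CRDU_def risk_conforming_def continuous_capacity_def Q_eq_P)

lemma R_iff: "\<lbrakk>X \<in> acts Q; Y \<in> acts Q\<rbrakk> \<Longrightarrow>
    R X Y \<longleftrightarrow> choquet (space Q) \<kappa> (u \<circ> X) \<ge> choquet (space Q) \<kappa> (u \<circ> Y)"
  using crdu by (auto simp: CRDU_def)

lemma \<kappa>: "continuous_capacity Q \<kappa>" "capacity Q \<kappa>"
  using continuous_capacity_distortion[OF \<nu>(1) g(1,2)] by (auto simp: continuous_capacity_def)

lemma \<kappa>_simps [simp]: "\<kappa> {} = 0" "\<kappa> (space Q) = 1"
  using \<kappa>(2) by (auto simp: capacity_def)

lemma \<kappa>_mono: "\<lbrakk>A \<in> sets Q; B \<in> sets Q; A \<subseteq> B\<rbrakk> \<Longrightarrow> \<kappa> A \<le> \<kappa> B"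
  using \<kappa>(2) by (auto simp: capacity_def)

lemma acts_subalg: "acts P \<subseteq> acts Q"
  using subalg measurable_from_subalg[OF subalg] by (auto simp: acts_def subalgebra_def)

lemma level_sets_P: "X \<in> acts P \<Longrightarrow> level X x \<in> sets P"
  using upper_level_sets[of X P x] subalg by (simp add: subalgebra_def)

lemma indicator_act_P: "A \<in> sets P \<Longrightarrow> indicator_act Q A \<in> acts P"
  using indicator_act_acts[of A P] subalg by (simp add: indicator_act_def subalgebra_def)

text \<open>Atomlessness enters here, applied to the whole space. It supplies bets in
  \<open>\<G>\<close> that match a given event in capacity or in probability.\<close>

lemma P_event_exists:
  assumes "0 \<le> a" "a \<le> 1"
  obtains B where "B \<in> sets P" "measure Q B = a"
proof -
  have "space P = space Q" "space P \<in> sets P"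
    using subalg sets.top[of P] by (simp_all only: subalgebra_def)
  then have "a \<in> {0..measure P (space P)}"
    using assms Q_eq_P[of "space P"] prob_space by simp
  then have "a \<in> measure P ` {B \<in> sets P. B \<subseteq> space P}"
    using atomless \<open>space P \<in> sets P\<close> unfolding atomless_def by blast
  then show ?thesis
    using that Q_eq_P by auto
qed

section \<open>Invariance of \<open>\<kappa>\<close> under null sets\<close>

text \<open>NSC makes the two bets indifferent, and the Choquet value of a bet is strictly
  increasing in the capacity of its event.\<close>

lemma \<kappa>_AE_eq:
  assumes A: "A \<in> sets Q" and B: "B \<in> sets Q" and "AE \<omega> in Q. \<omega> \<in> A \<longleftrightarrow> \<omega> \<in> B"
  shows "\<kappa> A = \<kappa> B"
proof -
  have "u 0 < u 1"
    using u by (simp add: strict_mono_less)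
  have "AE \<omega> in Q. indicator_act Q A \<omega> = indicator_act Q B \<omega>"
    using assms(3) by eventually_elim (auto simp: indicator_act_def indicator_def restrict_def)
  moreover note [measurable] = A B
  have "{\<omega> \<in> space Q. indicator_act Q A \<omega> = indicator_act Q B \<omega>} =
      {\<omega> \<in> space Q. \<omega> \<in> A \<longleftrightarrow> \<omega> \<in> B}"
    by (auto simp: indicator_act_def indicator_def)
  then have "{\<omega> \<in> space Q. indicator_act Q A \<omega> = indicator_act Q B \<omega>} \<in> sets Q"
    by simp
  ultimately have "prob {\<omega> \<in> space Q. indicator_act Q A \<omega> = indicator_act Q B \<omega>} = 1"
    by (subst prob_Collect_eq_1) auto
  then have "R (indicator_act Q A) (indicator_act Q B)" "R (indicator_act Q B) (indicator_act Q A)"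
    using nsc indicator_act_acts[OF A] indicator_act_acts[OF B] unfolding NSC_def by blast+
  then show ?thesis
    using \<open>u 0 < u 1\<close>
    by (simp add: R_iff indicator_act_acts A B choquet_indicator_act u del: comp_apply)
qed

text \<open>For nested events, equal probability makes the difference a null set.\<close>

lemma \<kappa>_nested_eq:
  assumes A: "A \<in> sets Q" and B: "B \<in> sets Q" and "A \<subseteq> B \<or> B \<subseteq> A" "prob A = prob B"
  shows "\<kappa> A = \<kappa> B"
proof -
  have *: "AE \<omega> in Q. \<omega> \<in> A \<longleftrightarrow> \<omega> \<in> B"
    if "A \<in> sets Q" "B \<in> sets Q" "A \<subseteq> B" "prob A = prob B" for A B
  proof -
    have "AE \<omega> in Q. \<omega> \<notin> B - A"
      using that finite_measure_Diff[of B A]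
      by (intro AE_not_in) (auto simp: null_sets_def emeasure_eq_measure)
    then show ?thesis
    proof eventually_elim
      case (elim \<omega>)
      with \<open>A \<subseteq> B\<close> show ?case
        by auto
    qed
  qed
  from assms(3) show ?thesis
    using \<kappa>_AE_eq[OF A B] \<kappa>_AE_eq[OF B A] *[of A B] *[of B A] assms by argo
qed

lemma \<kappa>_level_eq:
  assumes "X \<in> acts Q" "Y \<in> acts Q" "comonotonic (space Q) X Y" "prob (level X x) = prob (level Y y)"
  shows "\<kappa> (level X x) = \<kappa> (level Y y)"
  using assms comonotonic_upper_levels[OF assms(3)]
  by (intro \<kappa>_nested_eq upper_level_sets) auto

section \<open>Construction of a distortion family\<close>

text \<open>Hence 0 and 1 are level probabilities of every act, which fixes the endpoint values of
  \<open>G0 X\<close>.\<close>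

lemma levels_extreme:
  assumes "X \<in> acts Q"
  obtains K where "level X K = {}" "level X (- K) = space Q"
proof -
  obtain K where K: "\<And>\<omega>. \<omega> \<in> space Q \<Longrightarrow> \<bar>X \<omega>\<bar> < K"
    using actsE[OF assms] by metis
  then have "- K < X \<omega>" "X \<omega> < K" if "\<omega> \<in> space Q" for \<omega>
    using that by fastforce+
  then show ?thesis
    by (intro that[of K]) (fastforce simp: upper_level_def)+
qed

lemma level_probs_indicator_act:
  assumes "A \<in> sets Q"
  shows "prob A \<in> level_probs Q (indicator_act Q A)"
  by (auto simp: level_probs_def upper_level_indicator_act[OF assms] intro!: image_eqI[of _ _ 0])

text \<open>Condition (a) of a distortion family compares \<open>G\<close> at indicator acts on all of \<open>[0,1]\<close>, not
  only on the level probabilities. The step extension used for other acts violates it, so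
  indicator acts get the extension that is constant on the open unit interval.\<close>

definition G0 :: "('a \<Rightarrow> real) \<Rightarrow> real \<Rightarrow> real" where
  "G0 X \<alpha> = (if X \<in> indicator_act Q ` sets Q
     then (if \<alpha> \<le> 0 then 0 else if \<alpha> < 1 then \<kappa> (level X 0) else 1)
     else (SUP x\<in>{x. prob (level X x) \<le> \<alpha>}. \<kappa> (level X x)))"

lemma G0_indicator_act:
  assumes "A \<in> sets Q"
  shows "G0 (indicator_act Q A) \<alpha> = (if \<alpha> \<le> 0 then 0 else if \<alpha> < 1 then \<kappa> A else 1)"
  using assms by (simp add: G0_def upper_level_indicator_act del: comp_apply)

text \<open>If the thresholds are in the wrong order, inclusion forces equal probabilities, and null
  invariance gives equality. Thus the supremum in \<open>G0\<close> is attained.\<close>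

lemma \<kappa>_level_le:
  assumes X: "X \<in> acts Q" and le: "prob (level X y) \<le> prob (level X x)"
  shows "\<kappa> (level X y) \<le> \<kappa> (level X x)"
proof (cases "x \<le> y")
  case True
  then show ?thesis
    by (intro \<kappa>_mono upper_level_sets X upper_level_antimono)
next
  case False
  then have "level X x \<subseteq> level X y"
    by (intro upper_level_antimono) auto
  then have "\<kappa> (level X y) = \<kappa> (level X x)"
    using le by (intro \<kappa>_nested_eq upper_level_sets X)
      (auto intro!: antisym finite_measure_mono upper_level_sets X)
  then show ?thesis
    by simp
qed

lemma G0_level:
  assumes X: "X \<in> acts Q"
  shows "G0 X (prob (level X x)) = \<kappa> (level X x)"
proof (cases "X \<in> indicator_act Q ` sets Q")
  case True
  then obtain A where A: "A \<in> sets Q" "X = indicator_act Q A"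
    by auto
  \<comment> \<open>At arguments 0 and 1 the extension ignores \<open>\<kappa> A\<close>. This is
    consistent, as null and almost sure events have the capacity of the empty set and of the whole
    space.\<close>
  have "\<kappa> A = 0" if "prob A \<le> 0"
    using \<kappa>_nested_eq[OF A(1), of "{}"] that measure_nonneg[of Q A] by (simp del: comp_apply)
  moreover have "\<kappa> A = 1" if "\<not> prob A < 1"
    using \<kappa>_nested_eq[OF A(1), of "space Q"] that prob_le_1[of A] sets.sets_into_space[OF A(1)]
    by (simp add: prob_space del: comp_apply)
  ultimately show ?thesis
    by (auto simp: A G0_indicator_act upper_level_indicator_act prob_space simp del: comp_apply)
next
  case False
  have "(SUP y\<in>{y. prob (level X y) \<le> prob (level X x)}. \<kappa> (level X y)) = \<kappa> (level X x)"
    using \<kappa>_level_le[OF X] by (intro cSup_eq_maximum) auto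
  then show ?thesis
    using False by (simp add: G0_def del: comp_apply)
qed

lemma distortion_G0:
  assumes X: "X \<in> acts Q"
  shows "distortion (G0 X)"
proof -
  obtain K where K: "level X K = {}" "level X (- K) = space Q"
    using levels_extreme[OF X] by metis
  have 0: "G0 X 0 = 0" and 1: "G0 X 1 = 1"
    using G0_level[OF X, of K] G0_level[OF X, of "-K"] by (simp_all add: K prob_space del: comp_apply)
  note bounds = capacity_bounds[OF \<kappa>(2) upper_level_sets[OF X]]
  have mono: "mono_on {0..1} (G0 X)"
  proof (rule mono_onI)
    fix r s :: real assume rs: "r \<in> {0..1}" "s \<in> {0..1}" "r \<le> s"
    \<comment> \<open>The level set at \<open>K\<close> is empty, so the index set of the smaller
      supremum is nonempty.\<close>
    have "K \<in> {x. prob (level X x) \<le> r}"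
      using K rs by simp
    moreover have "bdd_above ((\<lambda>x. \<kappa> (level X x)) ` S)" for S
      using bounds by (auto intro!: bdd_aboveI[of _ 1])
    ultimately have "(SUP x\<in>{x. prob (level X x) \<le> r}. \<kappa> (level X x)) \<le>
      (SUP x\<in>{x. prob (level X x) \<le> s}. \<kappa> (level X x))"
      using rs by (intro cSUP_subset_mono) auto
    then show "G0 X r \<le> G0 X s"
      using rs bounds by (auto simp: G0_def simp del: comp_apply)
  qed
  moreover have "G0 X r \<in> {0..1}" if "r \<in> {0..1}" for r
    using mono_onD[OF mono, of 0 r] mono_onD[OF mono, of r 1] that by (auto simp: 0 1)
  ultimately show ?thesis
    by (auto simp: distortion_def 0 1)
qed

text \<open>Level sets of one act are nested, so the distance of two level probabilities is the
  \<open>Q\<close>-measure of the symmetric difference of the level sets.\<close>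

lemma continuous_G0:
  assumes X: "X \<in> acts Q"
  shows "continuous_on (level_probs Q X) (G0 X)"
  unfolding continuous_on_iff
proof (intro ballI allI impI)
  fix \<alpha> e :: real assume "\<alpha> \<in> level_probs Q X" and "e > 0"
  then obtain x where x: "\<alpha> = prob (level X x)"
    by (auto simp: level_probs_def)
  have "\<exists>d>0. \<forall>B\<in>sets Q. prob (sym_diff (level X x) B) < d \<longrightarrow> \<bar>\<kappa> B - \<kappa> (level X x)\<bar> < e"
    by (rule capacity_continuous_sym_diff[OF prob_space_axioms \<kappa>(1) _ upper_level_sets[OF X] \<open>e > 0\<close>])
      (rule \<kappa>_AE_eq)
  then obtain d where d: "d > 0" "\<And>B. \<lbrakk>B \<in> sets Q; prob (sym_diff (level X x) B) < d\<rbrakk> \<Longrightarrow>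
      \<bar>\<kappa> B - \<kappa> (level X x)\<bar> < e"
    by blast
  show "\<exists>d>0. \<forall>\<beta>\<in>level_probs Q X. dist \<beta> \<alpha> < d \<longrightarrow> dist (G0 X \<beta>) (G0 X \<alpha>) < e"
  proof (intro exI[of _ d] conjI ballI impI)
    fix \<beta> assume "\<beta> \<in> level_probs Q X" and *: "dist \<beta> \<alpha> < d"
    then obtain y where y: "\<beta> = prob (level X y)"
      by (auto simp: level_probs_def)
    note sets = upper_level_sets[OF X]
    have "prob (sym_diff (level X x) (level X y)) = \<bar>prob (level X x) - prob (level X y)\<bar>"
    proof (cases "x \<le> y")
      case True
      then have "level X y \<subseteq> level X x"
        by (rule upper_level_antimono)
      moreover from this have "sym_diff (level X x) (level X y) = level X x - level X y"
        by auto
      ultimately show ?thesis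
        using finite_measure_mono[of "level X y" "level X x"]
        by (simp add: finite_measure_Diff sets)
    next
      case False
      then have "level X x \<subseteq> level X y"
        by (intro upper_level_antimono) auto
      moreover from this have "sym_diff (level X x) (level X y) = level X y - level X x"
        by auto
      ultimately show ?thesis
        using finite_measure_mono[of "level X x" "level X y"]
        by (simp add: finite_measure_Diff sets)
    qed
    then have "\<bar>\<kappa> (level X y) - \<kappa> (level X x)\<bar> < e"
      using * by (intro d sets) (simp add: x y dist_real_def abs_minus_commute)
    then show "dist (G0 X \<beta>) (G0 X \<alpha>) < e"
      by (simp add: x y G0_level[OF X] dist_real_def del: comp_apply)
  qed (use d in auto)
qed

text \<open>Condition (a) is monotonicity of \<open>\<kappa>\<close>, (c) is
  \<open>\<kappa>_level_eq\<close>, and on acts of \<open>\<G>\<close> risk conformity turns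
  \<open>\<kappa>\<close> into \<open>g\<close> of the probability.\<close>

lemma g_distortion_family_G0: "g_distortion_family Q P g G0"
  unfolding g_distortion_family_def distortion_family_def
proof (intro conjI ballI impI)
  fix A B \<alpha> assume AB: "A \<in> sets Q" "B \<in> sets Q" "A \<subseteq> B"
  then show "G0 (indicator_act Q A) \<alpha> \<le> G0 (indicator_act Q B) \<alpha>"
    using \<kappa>_mono[OF AB] by (simp add: G0_indicator_act del: comp_apply)
next
  fix X Y \<alpha> assume XY: "X \<in> acts Q" "Y \<in> acts Q" "comonotonic (space Q) X Y"
    and "\<alpha> \<in> level_probs Q X \<inter> level_probs Q Y"
  then obtain x y where "\<alpha> = prob (level X x)" "\<alpha> = prob (level Y y)"
    unfolding level_probs_def by blast
  then show "G0 X \<alpha> = G0 Y \<alpha>"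
    using G0_level[OF XY(1), of x] G0_level[OF XY(2), of y] \<kappa>_level_eq[OF XY, of x y]
    by (simp del: comp_apply)
next
  fix X \<alpha> assume X: "X \<in> acts P" "\<alpha> \<in> level_probs Q X"
  then obtain x where x: "\<alpha> = prob (level X x)"
    by (auto simp: level_probs_def)
  show "G0 X \<alpha> = g \<alpha>"
    using X acts_subalg G0_level[of X x] \<nu>(3)[OF level_sets_P[OF X(1)]] by (auto simp: x)
qed (auto intro: distortion_G0 continuous_G0)

section \<open>Representation of the preference and uniqueness\<close>

text \<open>Every level set of \<open>u \<circ> X\<close> is a level set of \<open>X\<close>, where
  \<open>G X \<circ> prob\<close> and \<open>\<kappa>\<close> agree.\<close>

lemma choquet_family:
  assumes X: "X \<in> acts Q" and G: "\<And>x. G X (prob (level X x)) = \<kappa> (level X x)"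
  shows "choquet (space Q) (G X \<circ> prob) (u \<circ> X) = choquet (space Q) \<kappa> (u \<circ> X)"
proof (rule choquet_cong)
  fix x
  obtain K where K: "K > 0" "\<And>\<omega>. \<omega> \<in> space Q \<Longrightarrow> \<bar>X \<omega>\<bar> < K"
    using actsE[OF X] by metis
  obtain y where "level (u \<circ> X) x = level X y"
    using upper_level_strict_mono_comp[OF u K(1), of x] K(2) by metis
  then show "(G X \<circ> prob) (level (u \<circ> X) x) = \<kappa> (level (u \<circ> X) x)"
    using G by simp
qed

lemma family_represents_G0: "family_represents Q R u G0"
  by (simp add: family_represents_def R_iff choquet_family[where G = G0] G0_level del: comp_apply)

text \<open>Comonotonicity with indicators of level sets reduces to indicator acts, each of which is
  indifferent to a bet on an event of \<open>\<G>\<close> with the same capacity; on such bets \<open>G\<close> is known.\<close>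

lemma family_level:
  assumes G: "g_distortion_family Q P g G" "family_represents Q R u G" and X: "X \<in> acts Q"
  shows "G X (prob (level X x)) = \<kappa> (level X x)"
proof -
  define A where "A = level X x"
  have A: "A \<in> sets Q"
    using X by (simp add: A_def upper_level_sets)
  obtain B where B: "B \<in> sets P" "prob B = \<nu> A"
    using P_event_exists[of "\<nu> A"] capacity_bounds[OF \<nu>(2) A] by metis
  have BQ: "B \<in> sets Q"
    using B subalg by (auto simp: subalgebra_def)
  let ?IA = "indicator_act Q A" and ?IB = "indicator_act Q B"
  note acts = indicator_act_acts[OF A] indicator_act_acts[OF BQ]
  have "u 0 < u 1"
    using u by (simp add: strict_mono_less)
  have fam: "distortion_family Q G"
    using G by (simp add: g_distortion_family_def)
  then have dist: "G Y 0 = 0" "G Y 1 = 1" if "Y \<in> acts Q" for Y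
    using that by (auto simp: distortion_family_def distortion_def)
  have "\<kappa> A = \<kappa> B"
    using B \<nu>(3) by simp
  then have "choquet (space Q) \<kappa> (u \<circ> ?IA) = choquet (space Q) \<kappa> (u \<circ> ?IB)"
    by (simp add: choquet_indicator_act A BQ u del: comp_apply)
  then have "R ?IA ?IB" "R ?IB ?IA"
    using acts by (auto simp: R_iff)
  then have "choquet (space Q) (G ?IA \<circ> prob) (u \<circ> ?IA) = choquet (space Q) (G ?IB \<circ> prob) (u \<circ> ?IB)"
    using G(2) acts unfolding family_represents_def by (metis antisym)
  \<comment> \<open>Members of the family are distortions, so \<open>G ?IA \<circ> prob\<close> and
    \<open>G ?IB \<circ> prob\<close> are 0 at the empty set and 1 at the whole space, and
    \<open>choquet_indicator_act\<close> evaluates both sides.\<close>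
  then have "(u 1 - u 0) * G ?IA (prob A) = (u 1 - u 0) * G ?IB (prob B)"
    using dist acts by (simp add: choquet_indicator_act A BQ u prob_space)
  then have "G ?IA (prob A) = G ?IB (prob B)"
    using \<open>u 0 < u 1\<close> by simp
  also have "\<dots> = g (prob B)"
    using G(1) indicator_act_P[OF B(1)] level_probs_indicator_act[OF BQ]
    by (simp add: g_distortion_family_def)
  also have "\<dots> = \<kappa> A"
    using B by simp
  finally have "G ?IA (prob A) = \<kappa> A" .
  moreover have "G X (prob A) = G ?IA (prob A)"
  proof -
    have "prob A \<in> level_probs Q X \<inter> level_probs Q ?IA"
      using level_probs_indicator_act[OF A] by (auto simp: level_probs_def A_def)
    moreover have "comonotonic (space Q) X ?IA"
      unfolding A_def by (rule comonotonic_indicator_upper_level)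
    ultimately show ?thesis
      using fam X acts unfolding distortion_family_def by blast
  qed
  ultimately show ?thesis
    by (simp add: A_def)
qed

section \<open>Ambiguity aversion and Property (RAA)\<close>

text \<open>By \<open>family_level\<close> the family takes the values of \<open>\<kappa>\<close> on
  level sets, and each event is the level set of its indicator at threshold 0.\<close>

lemma ambiguity_averse_iff:
  assumes G: "g_distortion_family Q P g G" "family_represents Q R u G"
  shows "ambiguity_averse Q g G \<longleftrightarrow> (\<forall>A\<in>sets Q. \<kappa> A \<le> g (prob A))"
proof
  assume *: "ambiguity_averse Q g G"
  show "\<forall>A\<in>sets Q. \<kappa> A \<le> g (prob A)"
  proof
    fix A assume A: "A \<in> sets Q"
    have "G (indicator_act Q A) (prob A) = \<kappa> A"
      using family_level[OF G indicator_act_acts[OF A], of 0]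
      by (simp add: upper_level_indicator_act[OF A])
    then show "\<kappa> A \<le> g (prob A)"
      using * level_probs_indicator_act[OF A] indicator_act_acts[OF A]
      unfolding ambiguity_averse_def by metis
  qed
next
  assume *: "\<forall>A\<in>sets Q. \<kappa> A \<le> g (prob A)"
  then show "ambiguity_averse Q g G"
    using family_level[OF G] upper_level_sets
    by (fastforce simp: ambiguity_averse_def level_probs_def simp del: comp_apply)
qed

text \<open>One direction tests RAA on a bet in \<open>\<G>\<close> with the same probability. For
  the other, a level set of the \<open>\<G>\<close>-measurable act has capacity \<open>g\<close> of
  the common probability, so the Choquet integrands are ordered pointwise.\<close>

lemma RAA_iff: "RAA Q P R \<longleftrightarrow> (\<forall>A\<in>sets Q. \<kappa> A \<le> g (prob A))"
proof
  assume RAA: "RAA Q P R"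
  show "\<forall>A\<in>sets Q. \<kappa> A \<le> g (prob A)"
  proof
    fix A assume A: "A \<in> sets Q"
    obtain B where B: "B \<in> sets P" "prob B = prob A"
      using P_event_exists[of "prob A"] by auto
    have BQ: "B \<in> sets Q"
      using B subalg by (auto simp: subalgebra_def)
    have "prob (level (indicator_act Q B) x) = prob (level (indicator_act Q A) x)" for x
      using B by (simp add: upper_level_indicator_act A BQ)
    then have "R (indicator_act Q B) (indicator_act Q A)"
      using RAA indicator_act_P[OF B(1)] indicator_act_acts[OF A] unfolding RAA_def by blast
    moreover have "u 0 < u 1"
      using u by (simp add: strict_mono_less)
    ultimately have "\<kappa> A \<le> \<kappa> B"
      by (simp add: R_iff indicator_act_acts A BQ choquet_indicator_act u del: comp_apply)
    then show "\<kappa> A \<le> g (prob A)"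
      using B \<nu>(3) by simp
  qed
next
  assume le: "\<forall>A\<in>sets Q. \<kappa> A \<le> g (prob A)"
  show "RAA Q P R"
    unfolding RAA_def
  proof (intro ballI impI)
    fix X Y assume X: "X \<in> acts P" and Y: "Y \<in> acts Q"
      and eq: "\<forall>x. prob (level X x) = prob (level Y x)"
    have XQ: "X \<in> acts Q"
      using X acts_subalg by auto
    obtain K1 where K1: "K1 > 0" "\<And>\<omega>. \<omega> \<in> space Q \<Longrightarrow> \<bar>X \<omega>\<bar> < K1"
      using actsE[OF XQ] by metis
    obtain K2 where K2: "K2 > 0" "\<And>\<omega>. \<omega> \<in> space Q \<Longrightarrow> \<bar>Y \<omega>\<bar> < K2"
      using actsE[OF Y] by metis
    define K where "K = max K1 K2"
    have K: "K > 0" "\<And>\<omega>. \<omega> \<in> space Q \<Longrightarrow> \<bar>X \<omega>\<bar> < K" "\<And>\<omega>. \<omega> \<in> space Q \<Longrightarrow> \<bar>Y \<omega>\<bar> < K"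
      using K1 K2 by (auto simp: K_def less_max_iff_disj)
    \<comment> \<open>One threshold \<open>y\<close> must serve both acts, because \<open>eq\<close>
      relates their probabilities at equal thresholds only; hence the common bound
      \<open>K\<close>.\<close>
    have common: "\<exists>y. level (u \<circ> X) x = level X y \<and> level (u \<circ> Y) x = level Y y" for x
      using upper_level_strict_mono_comp[OF u K(1), of x] K(2,3) by metis
    \<comment> \<open>As \<open>L\<close> bounds \<open>u\<close> on \<open>{-K..K}\<close>, both
      level functions are 1 below \<open>-L\<close> and 0 above \<open>L\<close>.\<close>
    define L where "L = max \<bar>u K\<bar> \<bar>u (- K)\<bar>"
    have uK: "- L \<le> u (Z \<omega>) \<and> u (Z \<omega>) \<le> L" if "\<bar>Z \<omega>\<bar> < K" for Z :: "'a \<Rightarrow> real" and \<omega>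
    proof -
      have "u (- K) \<le> u (Z \<omega>)" "u (Z \<omega>) \<le> u K"
        using that by (auto simp: strict_mono_less_eq[OF u(2)])
      then show ?thesis
        by (auto simp: L_def)
    qed
    have trivial: "level (u \<circ> Z) x = (if x < - L then space Q else {})"
      if "\<And>\<omega>. \<omega> \<in> space Q \<Longrightarrow> \<bar>Z \<omega>\<bar> < K" "x < - L \<or> x > L" "L \<ge> 0" for Z x
      using uK[of Z] that by (fastforce simp: upper_level_def)
    have "L \<ge> 0"
      by (simp add: L_def)
    have sets: "level (u \<circ> X) x \<in> sets Q" "level (u \<circ> Y) x \<in> sets Q" for x
      using common[of x] upper_level_sets XQ Y by metis+
    have "choquet (space Q) \<kappa> (u \<circ> Y) \<le> choquet (space Q) \<kappa> (u \<circ> X)"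
    proof (rule choquet_mono[where L = L, OF _ _ _ _ _ _ _ refl refl])
      show "antimono (\<lambda>x. \<kappa> (level (u \<circ> Y) x))" "antimono (\<lambda>x. \<kappa> (level (u \<circ> X) x))"
        by (intro antimonoI \<kappa>_mono sets upper_level_antimono; assumption)+
      show "\<kappa> (level (u \<circ> Y) x) \<le> \<kappa> (level (u \<circ> X) x)" for x
      proof -
        obtain y where y: "level (u \<circ> X) x = level X y" "level (u \<circ> Y) x = level Y y"
          using common by blast
        have "\<kappa> (level Y y) \<le> g (prob (level Y y))"
          using le upper_level_sets[OF Y] by blast
        also have "\<dots> = \<kappa> (level X y)"
          using eq \<nu>(3)[OF level_sets_P[OF X]] by simp
        finally show ?thesis
          by (simp only: y)
      qed
    qed (use trivial[OF K(2)] trivial[OF K(3)] \<open>L \<ge> 0\<close> capacity_bounds[OF \<kappa>(2)] sets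
          in \<open>simp_all del: comp_apply\<close>)
    then show "R X Y"
      by (simp add: R_iff XQ Y)
  qed
qed

end

text \<open>Two representing families agree because \<open>family_level\<close> equates both with
  \<open>\<kappa>\<close> on level sets. The last conjunct covers every representing family, not
  only \<open>G0\<close>.\<close>

theorem theorem6:
  fixes Q P :: "'a measure"
    and R :: "('a \<Rightarrow> real) \<Rightarrow> ('a \<Rightarrow> real) \<Rightarrow> bool"
    and u g :: "real \<Rightarrow> real"
    and \<nu> :: "'a set \<Rightarrow> real"
  assumes "prob_space Q" and "prob_space P" and "subalgebra Q P"
    and "\<And>A. A \<in> sets P \<Longrightarrow> measure Q A = measure P A"
    and "atomless P"
    and "CRDU Q P R u g \<nu>"
    and "NSC Q R"
  shows "(\<exists>G. g_distortion_family Q P g G \<and> family_represents Q R u G) \<and>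
    (\<forall>G H. g_distortion_family Q P g G \<and> family_represents Q R u G \<and>
           g_distortion_family Q P g H \<and> family_represents Q R u H \<longrightarrow>
       (\<forall>X\<in>acts Q. \<forall>\<alpha>\<in>level_probs Q X. G X \<alpha> = H X \<alpha>)) \<and>
    (\<forall>G. g_distortion_family Q P g G \<and> family_represents Q R u G \<longrightarrow>
       (RAA Q P R \<longleftrightarrow> ambiguity_averse Q g G))"
proof -
  interpret crdu_nsc Q P R u g \<nu>
    using assms by (auto simp: crdu_nsc_def crdu_nsc_axioms_def)
  show ?thesis
  proof (intro conjI allI impI ballI)
    show "\<exists>G. g_distortion_family Q P g G \<and> family_represents Q R u G"
      using g_distortion_family_G0 family_represents_G0 by blast
  next
    fix G H X \<alpha>
    assume "g_distortion_family Q P g G \<and> family_represents Q R u G \<and>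
        g_distortion_family Q P g H \<and> family_represents Q R u H"
      and "X \<in> acts Q" "\<alpha> \<in> level_probs Q X"
    then show "G X \<alpha> = H X \<alpha>"
      using family_level[of G X] family_level[of H X] by (auto simp: level_probs_def)
  next
    fix G
    assume "g_distortion_family Q P g G \<and> family_represents Q R u G"
    then show "RAA Q P R \<longleftrightarrow> ambiguity_averse Q g G"
      using RAA_iff ambiguity_averse_iff by blast
  qed
qed

end
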